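(* Let $q$ be a prime power, $d\ge2$, let $\Lambda\subseteq\mathcal{K}_\infty^d$ be a lattice, $N\in\mathbb{N}$, let $\mathcal{C}$ be a convex body, and let $S$ be a $(\Lambda,q^N)$-periodic lattice. Then (1) $\lambda_{1,\mathcal{C}}(S)^d\le\dfrac{\det(\Lambda)}{q^N m(\mathcal{C})}$; (2) $\prod_{i=1}^d\lambda_{i,\mathcal{C}}(S)\le\dfrac{\det(\Lambda)}{q^N m(\mathcal{C})}$.
   Context: $\mathcal{R}=\mathbb{F}_q[x]$, $\mathcal{K}_\infty=\mathbb{F}_q((x^{-1}))$ with absolute value $|f/g|=q^{\deg f-\deg g}$, $\mathcal{O}=\mathbb{F}_q[[x^{-1}]]$, $\mathfrak{m}=x^{-1}\mathcal{O}$; $m$ is the Haar measure on $\mathcal{K}_\infty^d$ with $m(\mathcal O^d)=1$. A convex body is $\mathcal{C}=h\mathcal{O}^d$, $h\in\operatorname{GL}_d(\mathcal{K}_\infty)$, with norm $\|\mathbf v\|_{\mathcal C}=\max_i|(h^{-1}\mathbf v)_i|$. A lattice is $\Lambda=g\mathcal{R}^d$ with $\det(\Lambda)=|\det g|$ and $\mathcal{D}_\Lambda=g\mathfrak{m}^d$. A $(\Lambda,q^N)$-periodic lattice is an $\mathbb{F}_q$-subspace $S$ with $\Lambda+S=S$ and $\#(\mathcal{D}_\Lambda\cap S)=q^N$. Successive minima: $\lambda_{i,\mathcal{C}}(S)=\min\{r>0:\dim\operatorname{span}_{\mathcal{K}_\infty}(S\cap\{\|\mathbf{v}\|_{\mathcal{C}}\le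 r\})\ge i\}$. *)

theory Defs
  imports "HOL-Analysis.Analysis" "HOL-Computational_Algebra.Formal_Laurent_Series"
begin

(* F_q is a finite field type 'a with q = CARD('a).  K_infinity = F_q((1/x)) is the type
   'a fls, whose indeterminate fls_X stands for 1/x; thus x is fls_X_inv, and deg f is
   - fls_subdegree f.  Vectors of K_infinity^d have type ('a fls, 'n) vec with d = CARD('n). *)

definition fls_abs :: "'a::{finite,field} fls \<Rightarrow> real" where
  "fls_abs f = (if f = 0 then 0 else real CARD('a) powi (- fls_subdegree f))"

definition polys :: "'a::{finite,field} fls set" where
  "polys = range (\<lambda>p::'a poly. poly (map_poly fls_const p) fls_X_inv)"

definition int_ring :: "'a::{finite,field} fls set" where
  "int_ring = range fps_to_fls"

definition max_ideal :: "'a::{finite,field} fls set" where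
  "max_ideal = (*) fls_X ` int_ring"

definition vecs :: "'b set \<Rightarrow> ('b, 'n::finite) vec set" where
  "vecs A = {v. \<forall>i. v $ i \<in> A}"

(* Lattices and convex bodies are given by the matrix g or h in GL_d that presents them. *)

definition lattice :: "'a::{finite,field} fls ^ 'n ^ 'n \<Rightarrow> ('a fls ^ 'n::finite) set" where
  "lattice g = (*v) g ` vecs polys"

definition lattice_det :: "'a::{finite,field} fls ^ 'n ^ 'n::finite \<Rightarrow> real" where
  "lattice_det g = fls_abs (det g)"

definition fund_domain :: "'a::{finite,field} fls ^ 'n ^ 'n \<Rightarrow> ('a fls ^ 'n::finite) set" where
  "fund_domain g = (*v) g ` vecs max_ideal"

definition convex_body :: "'a::{finite,field} fls ^ 'n ^ 'n \<Rightarrow> ('a fls ^ 'n::finite) set" where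
  "convex_body h = (*v) h ` vecs int_ring"

definition body_norm :: "'a::{finite,field} fls ^ 'n ^ 'n \<Rightarrow> 'a fls ^ 'n::finite \<Rightarrow> real" where
  "body_norm h v = (MAX i. fls_abs ((matrix_inv h *v v) $ i))"

definition periodic_lattice ::
  "'a::{finite,field} fls ^ 'n ^ 'n \<Rightarrow> nat \<Rightarrow> ('a fls ^ 'n::finite) set \<Rightarrow> bool" where
  "periodic_lattice g N S \<longleftrightarrow>
     module.subspace (\<lambda>c v. fls_const c *s v) S \<and>
     {l + s | l s. l \<in> lattice g \<and> s \<in> S} = S \<and>
     card (fund_domain g \<inter> S) = CARD('a) ^ N"

definition succ_min ::
  "nat \<Rightarrow> 'a::{finite,field} fls ^ 'n ^ 'n \<Rightarrow> ('a fls ^ 'n::finite) set \<Rightarrow> real" where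
  "succ_min i h S =
     (LEAST r. r > 0 \<and> i \<le> vec.dim (vec.span (S \<inter> {v. body_norm h v \<le> r})))"

(* The library metric on 'a fls uses base 2 instead of q; it induces the same topology as
   fls_abs.  A translation-invariant Borel measure normalised on the compact open subgroup
   O^d is finite on compact sets and positive on nonempty open sets, so the predicate
   determines the Haar measure uniquely (regularity is automatic, the group being
   sigma-compact and metrizable). *)

definition normalized_haar :: "('a::{finite,field} fls ^ 'n::finite) measure \<Rightarrow> bool" where
  "normalized_haar m \<longleftrightarrow>
     sets m = sets borel \<and>
     (\<forall>v. \<forall>A\<in>sets m. emeasure m ((+) v ` A) = emeasure m A) \<and>
     emeasure m (vecs int_ring) = 1"

(* Scalar multiplication by F_q, so that module.subspace above has its intended meaning. *)
lemma vector_space_const_scale: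
  "vector_space (\<lambda>(c::'a::field) (v::'a fls ^ 'n::finite). fls_const c *s v)"
  by unfold_locales
     (simp_all add: vec_eq_iff algebra_simps flip: fls_plus_const fls_const_mult_const)

end

theory Submission
  imports Defs
begin

text \<open>Let \<open>D k\<close> be the dimension of the span of \<open>S\<^sub>k = S \<inter> x\<^sup>-\<^sup>k C\<close>. Leading coefficients embed
  \<open>S\<^sub>k / S\<^bsub>k+1\<^esub>\<close> into a residue space spanned by at most \<open>D k\<close> vectors, because lifts of independent
  residues are independent; hence \<open>card S\<^sub>k \<le> q\<^bsup>\<Sum>j\<ge>k. D j\<^esup>\<close>. The jumps of \<open>D\<close> are the successive minima, so
  this bounds \<open>card S\<^sub>k\<close> by their product. For very negative \<open>k\<close>, the ball \<open>x\<^sup>-\<^sup>k C\<close> is covered by the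
  translates of the fundamental domain by its lattice points, which bounds \<open>card S\<^sub>k\<close> from below by
  a ratio of volumes. Volumes of the sets \<open>g O\<^sup>d\<close> come from peeling off factors \<open>diag(1, \<dots>, X, \<dots>, 1)\<close>,
  each of index \<open>q\<close>, until the determinant is a unit.\<close>

no_notation fps_nth (infixl \<open>$\<close> 75)
notation fls_nth (infixl \<open>$$\<close> 75)

section \<open>Fractional ideals\<close>

text \<open>The ideal x^-k O, i.e. the elements of absolute value at most q^-k. A condition on
  coefficients covers 0 as well, although \<open>fls_subdegree 0\<close> is 0.\<close>

definition frac_ideal :: "int \<Rightarrow> 'a::{finite,field} fls set" where
  "frac_ideal k = {f. \<forall>n<k. f $$ n = 0}"

lemma frac_ideal_zero [simp]: "0 \<in> frac_ideal k"
  by (simp add: frac_ideal_def)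

lemma frac_ideal_one [simp]: "1 \<in> frac_ideal 0"
  by (simp add: frac_ideal_def)

lemma frac_ideal_add: "f \<in> frac_ideal k \<Longrightarrow> f' \<in> frac_ideal k \<Longrightarrow> f + f' \<in> frac_ideal k"
  by (simp add: frac_ideal_def)

lemma frac_ideal_diff: "f \<in> frac_ideal k \<Longrightarrow> f' \<in> frac_ideal k \<Longrightarrow> f - f' \<in> frac_ideal k"
  by (simp add: frac_ideal_def)

lemma frac_ideal_uminus: "f \<in> frac_ideal k \<Longrightarrow> - f \<in> frac_ideal k"
  by (simp add: frac_ideal_def)

lemma frac_ideal_sum: "(\<And>i. i \<in> I \<Longrightarrow> f i \<in> frac_ideal k) \<Longrightarrow> (\<Sum>i\<in>I. f i) \<in> frac_ideal k"
  by (induction I rule: infinite_finite_induct) (auto intro: frac_ideal_add)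

lemma frac_ideal_antimono: "k \<le> k' \<Longrightarrow> frac_ideal k' \<subseteq> frac_ideal k"
  by (auto simp: frac_ideal_def)

lemma frac_ideal_iff_subdegree: "f \<in> frac_ideal k \<longleftrightarrow> f = 0 \<or> k \<le> fls_subdegree f"
  by (auto simp: frac_ideal_def intro: fls_subdegree_geI)

lemma frac_ideal_mult: "f \<in> frac_ideal a \<Longrightarrow> f' \<in> frac_ideal b \<Longrightarrow> f * f' \<in> frac_ideal (a + b)"
  by (cases "f = 0 \<or> f' = 0") (auto simp: frac_ideal_iff_subdegree)

lemma frac_ideal_prod: "(\<And>i. i \<in> I \<Longrightarrow> f i \<in> frac_ideal 0) \<Longrightarrow> (\<Prod>i\<in>I. f i) \<in> frac_ideal 0"
proof (induction I rule: infinite_finite_induct)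
  case (insert i I)
  then show ?case
    using frac_ideal_mult[of "f i" 0 "prod f I" 0] by simp
qed auto

text \<open>The coefficient at \<open>a\<close> or \<open>b\<close> may itself be 0: then the
  valuation of the product exceeds \<open>a + b\<close> and both sides vanish. So leading
  coefficients are multiplicative relative to any lower bounds.\<close>

lemma nth_mult_frac_ideal:
  assumes "f \<in> frac_ideal a" "f' \<in> frac_ideal b"
  shows "(f * f') $$ (a + b) = f $$ a * f' $$ b"
proof (cases "f = 0 \<or> f' = 0")
  case False
  then have sub: "a \<le> fls_subdegree f" "b \<le> fls_subdegree f'"
    using assms by (auto simp: frac_ideal_iff_subdegree)
  show ?thesis
  proof (cases "a = fls_subdegree f \<and> b = fls_subdegree f'")
    case True
    then show ?thesis by simp
  next
    case neq: False
    then have "a + b < fls_subdegree f + fls_subdegree f'"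
      using sub by auto
    moreover have "f $$ a = 0 \<or> f' $$ b = 0"
      using neq sub by force
    ultimately show ?thesis
      by (simp add: fls_times_nth_eq0)
  qed
qed auto

lemma nth_prod_frac_ideal:
  "(\<And>i. i \<in> I \<Longrightarrow> f i \<in> frac_ideal 0) \<Longrightarrow> (\<Prod>i\<in>I. f i) $$ 0 = (\<Prod>i\<in>I. f i $$ 0)"
proof (induction I rule: infinite_finite_induct)
  case (insert i I)
  then show ?case
    using nth_mult_frac_ideal[of "f i" 0 "prod f I" 0] frac_ideal_prod[of I f] by simp
qed auto

lemma fls_nth_sum: "(\<Sum>i\<in>I. f i) $$ n = (\<Sum>i\<in>I. f i $$ n)"
  by (induction I rule: infinite_finite_induct) auto

lemma frac_ideal_shift: "fls_X * f \<in> frac_ideal (k + 1) \<longleftrightarrow> f \<in> frac_ideal k"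
  by (cases "f = 0") (auto simp: frac_ideal_iff_subdegree)

lemma int_ring_eq: "int_ring = frac_ideal 0"
proof -
  have "f \<in> int_ring" if "f \<in> frac_ideal 0" for f :: "'a fls"
  proof -
    have "fps_to_fls (fls_regpart f) = f"
      using that by (intro fls_regpart_to_fls_trivial) (auto simp: frac_ideal_iff_subdegree)
    then show ?thesis
      unfolding int_ring_def by (metis rangeI)
  qed
  then show ?thesis
    by (auto simp: int_ring_def frac_ideal_def)
qed

lemma max_ideal_eq: "max_ideal = frac_ideal 1"
proof -
  have "f \<in> max_ideal" if "f \<in> frac_ideal 1" for f :: "'a fls"
  proof -
    have "f = fls_X * fls_shift 1 f"
      by (simp add: fls_X_times_conv_shift)
    moreover from this have "fls_shift 1 f \<in> frac_ideal 0"
      using that by (auto simp: frac_ideal_def)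
    ultimately show ?thesis
      unfolding max_ideal_def int_ring_eq by blast
  qed
  then show ?thesis
    using frac_ideal_shift[of _ 0] by (auto simp: max_ideal_def int_ring_eq)
qed

section \<open>Polynomials in x inside K_infinity\<close>

lemma nth_poly_X_inv:
  fixes p :: "'a::{finite,field} poly"
  shows "poly (map_poly fls_const p) fls_X_inv $$ n = (if n \<le> 0 then coeff p (nat (- n)) else 0)"
proof (induction p arbitrary: n)
  case (pCons c p)
  have "map_poly fls_const (pCons c p) = pCons (fls_const c) (map_poly fls_const p)"
    by (rule map_poly_pCons) simp
  then have "poly (map_poly fls_const (pCons c p)) fls_X_inv $$ n
      = fls_const c $$ n + poly (map_poly fls_const p) fls_X_inv $$ (n + 1)"
    by (simp add: fls_X_inv_times_conv_shift)
  also have "\<dots> = (if n \<le> 0 then coeff (pCons c p) (nat (- n)) else 0)"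
    using pCons.IH[of "n + 1"]
    by (cases "n < 0") (auto simp: coeff_pCons nat_diff_distrib not_less
        split: nat.splits intro: arg_cong[of _ _ "coeff p"])
  finally show ?case .
qed auto

lemma polys_eq: "polys = {f. \<forall>n>0. f $$ n = 0}"
proof (intro equalityI subsetI)
  fix f :: "'a fls"
  assume f: "f \<in> {f. \<forall>n>0. f $$ n = 0}"
  \<comment> \<open>\<open>fls_prpart\<close> holds only the coefficients at negative indices, so
    the one at index 0 is added separately.\<close>
  have "f = poly (map_poly fls_const (fls_prpart f + [:f $$ 0:])) fls_X_inv"
  proof (rule fls_eqI)
    fix n
    show "f $$ n = poly (map_poly fls_const (fls_prpart f + [:f $$ 0:])) fls_X_inv $$ n"
      using f by (cases n "0 :: int" rule: linorder_cases)
        (auto simp: nth_poly_X_inv coeff_pCons split: nat.splits)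
  qed
  then show "f \<in> polys"
    unfolding polys_def by blast
qed (auto simp: polys_def nth_poly_X_inv)

lemma polys_diff: "f \<in> polys \<Longrightarrow> f' \<in> polys \<Longrightarrow> f - f' \<in> polys"
  by (simp add: polys_eq)

lemma polys_Int_frac_ideal: "polys \<inter> frac_ideal 1 = {0}"
proof -
  have "f = 0" if "f \<in> polys" "f \<in> frac_ideal 1" for f :: "'a fls"
  proof (rule fls_eqI)
    fix n :: int
    show "f $$ n = 0 $$ n"
      using that by (cases "n < 1") (auto simp: polys_eq frac_ideal_def)
  qed
  then show ?thesis
    by (auto simp: polys_eq)
qed

text \<open>Indices up to 0 go to the polynomial, positive ones to the tail. With
  \<open>polys_Int_frac_ideal\<close> this makes m a set of representatives of K_infinity modulo
  R.\<close>

lemma polys_plus_frac_ideal: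
  obtains p r where "p \<in> polys" "r \<in> frac_ideal 1" "f = p + r"
proof
  define p where "p = poly (map_poly fls_const (fls_prpart f + [:f $$ 0:])) fls_X_inv"
  have nth: "p $$ n = (if n \<le> 0 then f $$ n else 0)" for n
    by (cases n "0 :: int" rule: linorder_cases)
       (auto simp: p_def nth_poly_X_inv coeff_pCons split: nat.splits)
  show "p \<in> polys" "f - p \<in> frac_ideal 1" "f = p + (f - p)"
    by (auto simp: polys_eq frac_ideal_def nth)
qed

text \<open>Only the coefficients at indices from \<open>k\<close> to 0 can be nonzero, and each
  takes finitely many values.\<close>

lemma finite_polys_Int_frac_ideal: "finite (polys \<inter> frac_ideal k :: 'a::{finite,field} fls set)"
proof (rule finite_imageD)
  have "fls_nth ` (polys \<inter> frac_ideal k :: 'a fls set)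
      \<subseteq> {F. \<forall>n. (n \<in> {k..0} \<longrightarrow> F n \<in> UNIV) \<and> (n \<notin> {k..0} \<longrightarrow> F n = 0)}"
    by (auto simp: polys_eq frac_ideal_def not_le)
  then show "finite (fls_nth ` (polys \<inter> frac_ideal k :: 'a fls set))"
    by (rule finite_subset) (intro finite_set_of_finite_funs; simp)
qed (simp add: inj_on_def fls_nth_inject)

lemma finite_vecs: "finite A \<Longrightarrow> finite (vecs A :: ('b ^ 'n::finite) set)"
proof (rule finite_imageD)
  assume "finite A"
  have "vec_nth ` (vecs A :: ('b ^ 'n) set)
      \<subseteq> {F. \<forall>i. (i \<in> UNIV \<longrightarrow> F i \<in> A) \<and> (i \<notin> UNIV \<longrightarrow> F i = undefined)}"
    by (auto simp: vecs_def)
  then show "finite (vec_nth ` (vecs A :: ('b ^ 'n) set))"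
    by (rule finite_subset) (intro finite_set_of_finite_funs; simp add: \<open>finite A\<close>)
qed (simp add: inj_on_def vec_nth_inject)

lemma card_field_gt_1: "1 < real CARD('a::{finite,field})"
proof -
  have "card {0, 1 :: 'a} \<le> CARD('a)"
    by (rule card_mono) auto
  then show ?thesis by simp
qed

lemma fls_abs_le_iff:
  "fls_abs (f :: 'a::{finite,field} fls) \<le> real CARD('a) powi (- k) \<longleftrightarrow> f \<in> frac_ideal k"
proof -
  have "real CARD('a) powi (- fls_subdegree f) \<le> real CARD('a) powi (- k) \<longleftrightarrow> k \<le> fls_subdegree f"
    using power_int_strict_increasing[of "- k" "- fls_subdegree f" "real CARD('a)"]
      power_int_increasing[of "- fls_subdegree f" "- k" "real CARD('a)"] card_field_gt_1[where 'a='a]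
    by (cases "k \<le> fls_subdegree f") auto
  then show ?thesis
    by (auto simp: fls_abs_def frac_ideal_iff_subdegree)
qed

section \<open>Matrices over the valuation ring\<close>

lemma vecs_frac_ideal_add: "v \<in> vecs (frac_ideal k) \<Longrightarrow> w \<in> vecs (frac_ideal k) \<Longrightarrow> v + w \<in> vecs (frac_ideal k)"
  by (simp add: vecs_def frac_ideal_add)

lemma vecs_frac_ideal_diff: "v \<in> vecs (frac_ideal k) \<Longrightarrow> w \<in> vecs (frac_ideal k) \<Longrightarrow> v - w \<in> vecs (frac_ideal k)"
  by (simp add: vecs_def frac_ideal_diff)

lemma matrix_vector_mult_frac_ideal:
  assumes "\<And>i j. A $ i $ j \<in> frac_ideal a" "v \<in> vecs (frac_ideal b)"
  shows "A *v v \<in> vecs (frac_ideal (a + b))"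
  using assms by (auto simp: vecs_def matrix_vector_mult_def intro!: frac_ideal_sum frac_ideal_mult)

lemma finite_subset_frac_ideal:
  assumes "finite F" shows "\<exists>k. F \<subseteq> frac_ideal k"
proof -
  have "f \<in> frac_ideal (Min (fls_subdegree ` F))" if "f \<in> F" for f
    using that assms by (auto simp: frac_ideal_iff_subdegree)
  then show ?thesis by blast
qed

lemma matrix_entries_frac_ideal:
  fixes A :: "'a::{finite,field} fls ^ 'n::finite ^ 'm::finite"
  obtains k where "\<And>i j. A $ i $ j \<in> frac_ideal k"
proof -
  obtain k where "(\<lambda>(i, j). A $ i $ j) ` UNIV \<subseteq> frac_ideal k"
    using finite_subset_frac_ideal[of "(\<lambda>(i, j). A $ i $ j) ` UNIV"] by auto
  then show ?thesis
    by (intro that[of k]) auto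
qed

text \<open>The coefficient at 0 is the reduction homomorphism from O to F_q, so it passes through
  the Leibniz formula.\<close>

lemma det_frac_ideal:
  assumes "\<And>i j. A $ i $ j \<in> frac_ideal 0"
  shows "det A \<in> frac_ideal 0" and "det A $$ 0 = det (\<chi> i j. A $ i $ j $$ 0)"
proof -
  have prod: "(\<Prod>i\<in>UNIV. A $ i $ p i) \<in> frac_ideal 0" for p
    using assms by (intro frac_ideal_prod)
  show "det A \<in> frac_ideal 0"
    unfolding det_def
  proof (rule frac_ideal_sum)
    fix p
    show "of_int (sign p) * (\<Prod>i\<in>UNIV. A $ i $ p i) \<in> frac_ideal 0"
      using prod[of p] by (auto simp: sign_def frac_ideal_uminus)
  qed
  have "(of_int (sign p) * (\<Prod>i\<in>UNIV. A $ i $ p i)) $$ 0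
      = of_int (sign p) * (\<Prod>i\<in>UNIV. A $ i $ p i $$ 0)" for p
    using nth_prod_frac_ideal[of UNIV "\<lambda>i. A $ i $ p i"] assms by (auto simp: sign_def)
  then show "det A $$ 0 = det (\<chi> i j. A $ i $ j $$ 0)"
    by (simp only: det_def fls_nth_sum vec_lambda_beta)
qed

text \<open>An integral determinant with nonzero reduction is a unit of O, so Cramer's rule solves
  \<open>A *v x = b\<close> with integral \<open>x\<close>.\<close>

lemma unimodular_image:
  fixes A :: "'a::{finite,field} fls ^ 'n::finite ^ 'n"
  assumes A: "\<And>i j. A $ i $ j \<in> frac_ideal 0" and det: "det A $$ 0 \<noteq> 0"
  shows "(*v) A ` vecs (frac_ideal 0) = vecs (frac_ideal 0)"
proof (intro equalityI subsetI)
  fix b :: "'a fls ^ 'n"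
  assume b: "b \<in> vecs (frac_ideal 0)"
  have nz: "det A \<noteq> 0" using det by auto
  define x where "x = (\<chi> k. det (\<chi> i j. if j = k then b $ i else A $ i $ j) / det A)"
  have "A *v x = b"
    using cramer[OF nz, of x b] by (simp add: x_def)
  moreover have "fls_subdegree (det A) = 0"
    using det det_frac_ideal(1)[OF A] by (intro fls_subdegree_eqI) (auto simp: frac_ideal_def)
  then have "inverse (det A) \<in> frac_ideal 0"
    by (simp add: frac_ideal_iff_subdegree)
  then have "det (\<chi> i j. if j = k then b $ i else A $ i $ j) * inverse (det A) \<in> frac_ideal (0 + 0)" for k
    using A b by (intro frac_ideal_mult det_frac_ideal(1)) (auto simp: vecs_def)
  then have "x \<in> vecs (frac_ideal 0)"
    by (simp add: x_def vecs_def divide_inverse)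
  ultimately show "b \<in> (*v) A ` vecs (frac_ideal 0)"
    by blast
next
  fix b assume "b \<in> (*v) A ` vecs (frac_ideal 0)"
  then show "b \<in> vecs (frac_ideal 0)"
    using matrix_vector_mult_frac_ideal[OF A, of _ 0] by auto
qed

text \<open>Multiplying an invertible \<open>g\<close> by this on the right scales column
  \<open>i\<close> by \<open>fls_X\<close>, which cuts the convex body down to a subgroup of index
  q.\<close>

definition diag_X :: "'n \<Rightarrow> 'a::{finite,field} fls ^ 'n ^ 'n::finite" where
  "diag_X i = (\<chi> j k. if j = k then if j = i then fls_X else 1 else 0)"

lemma diag_X_mult_vec: "(diag_X i *v v) $ j = (if j = i then fls_X * v $ j else v $ j)"
  by (simp add: diag_X_def matrix_vector_mult_def if_distrib[of "\<lambda>x. x * _"] cong: if_cong)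

lemma matrix_mult_diag_X: "(A ** diag_X i) $ j $ k = (if k = i then A $ j $ k * fls_X else A $ j $ k)"
  by (simp add: diag_X_def matrix_matrix_mult_def if_distrib[of "\<lambda>x. _ * x"] cong: if_cong)

lemma det_diag_X: "det (diag_X i :: 'a::{finite,field} fls ^ 'n ^ 'n::finite) = fls_X"
proof -
  have "det (diag_X i :: 'a fls ^ 'n ^ 'n) = (\<Prod>j\<in>UNIV. diag_X i $ j $ j)"
    by (rule det_diagonal) (simp add: diag_X_def)
  then show ?thesis
    by (simp add: diag_X_def)
qed

lemma convex_body_eq: "convex_body g = (*v) g ` vecs (frac_ideal 0)"
  by (simp add: convex_body_def int_ring_eq)

lemma fund_domain_eq: "fund_domain g = (*v) g ` vecs (frac_ideal 1)"
  by (simp add: fund_domain_def max_ideal_eq)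

lemma convex_body_mult_unimodular:
  assumes "\<And>i j. k $ i $ j \<in> frac_ideal 0" "det k $$ 0 \<noteq> 0"
  shows "convex_body (g ** k) = convex_body g"
  unfolding convex_body_eq using unimodular_image[OF assms]
  by (metis (no_types, lifting) image_image image_cong matrix_vector_mul_assoc)

lemma invertible_mult_eq_iff:
  assumes "invertible g" shows "g *v v = g *v w \<longleftrightarrow> v = w"
  by (metis assms invertible_def matrix_vector_mul_assoc matrix_vector_mul_lid)

text \<open>In the coordinates of \<open>g\<close>, the coset of \<open>c\<close> consists of the
  integral vectors whose coordinate \<open>i\<close> has reduction \<open>c\<close>, so the elements
  of F_q label the cosets.\<close>

lemma convex_body_diag_X_cosets:
  fixes g :: "'a::{finite,field} fls ^ 'n ^ 'n::finite"
  assumes "invertible g"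
  shows "convex_body g = (\<Union>c\<in>UNIV. (+) (g *v axis i (fls_const c)) ` convex_body (g ** diag_X i))"
    and "disjoint_family (\<lambda>c. (+) (g *v axis i (fls_const c)) ` convex_body (g ** diag_X i))"
proof -
  have split: "(\<exists>w\<in>vecs (frac_ideal 0). v = axis i (fls_const c) + diag_X i *v w)
      \<longleftrightarrow> v \<in> vecs (frac_ideal 0) \<and> v $ i $$ 0 = c" for v :: "'a fls ^ 'n" and c
  proof (intro iffI; elim conjE bexE)
    fix w assume w: "w \<in> vecs (frac_ideal 0)" "v = axis i (fls_const c) + diag_X i *v w"
    have "(fls_X * w $ i) \<in> frac_ideal 1"
      using w frac_ideal_shift[of "w $ i" 0] by (auto simp: vecs_def)
    then show "v \<in> vecs (frac_ideal 0) \<and> v $ i $$ 0 = c"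
      using w by (auto simp: vecs_def diag_X_mult_vec axis_def frac_ideal_def)
  next
    assume v: "v \<in> vecs (frac_ideal 0)" "v $ i $$ 0 = c"
    define w where "w = (\<chi> j. if j = i then fls_shift 1 (v $ i - fls_const c) else v $ j)"
    have "w \<in> vecs (frac_ideal 0)"
      using v by (auto simp: w_def vecs_def frac_ideal_def)
    moreover have "v = axis i (fls_const c) + diag_X i *v w"
      by (auto simp: vec_eq_iff diag_X_mult_vec w_def axis_def fls_X_times_conv_shift)
    ultimately show "\<exists>w\<in>vecs (frac_ideal 0). v = axis i (fls_const c) + diag_X i *v w"
      by blast
  qed
  have coset: "(+) (g *v axis i (fls_const c)) ` convex_body (g ** diag_X i)
      = (*v) g ` {v \<in> vecs (frac_ideal 0). v $ i $$ 0 = c}" for c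
  proof -
    have "(+) (g *v axis i (fls_const c)) ` convex_body (g ** diag_X i)
      = (*v) g ` {axis i (fls_const c) + diag_X i *v w | w. w \<in> vecs (frac_ideal 0)}"
      by (force simp: convex_body_eq image_iff matrix_vector_right_distrib matrix_vector_mul_assoc)
    also have "{axis i (fls_const c) + diag_X i *v w | w. w \<in> vecs (frac_ideal 0)}
        = {v \<in> vecs (frac_ideal 0). v $ i $$ 0 = c}"
      using split by blast
    finally show ?thesis .
  qed
  show "convex_body g = (\<Union>c\<in>UNIV. (+) (g *v axis i (fls_const c)) ` convex_body (g ** diag_X i))"
    unfolding coset by (auto simp: convex_body_eq)
  show "disjoint_family (\<lambda>c. (+) (g *v axis i (fls_const c)) ` convex_body (g ** diag_X i))"
    by (auto simp: disjoint_family_on_def coset invertible_mult_eq_iff[OF assms])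
qed

lemma open_add_frac_ideal: "open ((+) (a :: 'a::{finite,field} fls) ` frac_ideal k)"
proof -
  have "\<exists>r>0. {y. dist y b < r} \<subseteq> (+) a ` frac_ideal k" if b: "b \<in> (+) a ` frac_ideal k" for b
  proof (intro exI conjI subsetI)
    \<comment> \<open>The metric is \<open>2 powi (- fls_subdegree f)\<close> for a nonzero
      difference \<open>f\<close>, so a ball of this radius stays inside the coset of its centre
      modulo \<open>frac_ideal k\<close>.\<close>
    show "0 < (2::real) powi (- k)" by simp
    fix y assume y: "y \<in> {y. dist y b < (2::real) powi (- k)}"
    have "y - b \<in> frac_ideal k"
    proof (cases "y = b")
      case False
      then have "dist y b = 2 powi (- fls_subdegree (y - b))"
        by (auto simp: dist_fls_def power_int_def power_one_over inverse_eq_divide)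
      then have "(2::real) powi (- fls_subdegree (y - b)) < 2 powi (- k)"
        using y by simp
      then have "k \<le> fls_subdegree (y - b)"
        using power_int_increasing[of "- k" "- fls_subdegree (y - b)" "2::real"] by linarith
      then show ?thesis by (simp add: frac_ideal_iff_subdegree)
    qed simp
    moreover have "b - a \<in> frac_ideal k" using b by auto
    ultimately have "(y - b) + (b - a) \<in> frac_ideal k" by (rule frac_ideal_add)
    then show "y \<in> (+) a ` frac_ideal k"
      by (intro image_eqI[of _ _ "y - a"]) (auto simp: algebra_simps)
  qed
  then show ?thesis unfolding open_fls_def by blast
qed

section \<open>Haar measure of convex bodies\<close>

lemma matrix_inv_cancel:
  assumes "invertible (g :: 'a::field ^ 'n ^ 'n::finite)"
  shows "matrix_inv g *v (g *v v) = v" and "g *v (matrix_inv g *v v) = v"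
  using someI_ex[OF assms[unfolded invertible_def]]
  by (simp_all add: matrix_vector_mul_assoc flip: matrix_inv_def)

lemma open_translate_image_frac_ideal:
  fixes g :: "'a::{finite,field} fls ^ 'n ^ 'n::finite"
  assumes g: "invertible g"
  shows "open ((+) a ` (*v) g ` vecs (frac_ideal k))" (is "open ?S")
  unfolding open_vec_def
proof
  fix b assume b: "b \<in> ?S"
  \<comment> \<open>As the entries of \<open>matrix_inv g\<close> lie in
    \<open>frac_ideal l\<close>, a perturbation in \<open>frac_ideal (k - l)\<close> moves the
    coordinates with respect to \<open>g\<close> only by \<open>frac_ideal k\<close>.\<close>
  obtain l where l: "\<And>i j. matrix_inv g $ i $ j \<in> frac_ideal l"
    using matrix_entries_frac_ideal by metis
  have "y \<in> ?S" if y: "\<And>i. y $ i \<in> (+) (b $ i) ` frac_ideal (k - l)" for y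
  proof -
    obtain w where w: "w \<in> vecs (frac_ideal k)" "b = a + g *v w"
      using b by auto
    have "(y - b) $ i \<in> frac_ideal (k - l)" for i
      using y[of i] by auto
    then have "y - b \<in> vecs (frac_ideal (k - l))"
      by (simp add: vecs_def)
    then have "matrix_inv g *v (y - b) \<in> vecs (frac_ideal k)"
      using matrix_vector_mult_frac_ideal[OF l] by fastforce
    then have "w + matrix_inv g *v (y - b) \<in> vecs (frac_ideal k)"
      using w by (intro vecs_frac_ideal_add)
    moreover have "y = a + g *v (w + matrix_inv g *v (y - b))"
      using w by (simp add: matrix_vector_right_distrib matrix_inv_cancel[OF g])
    ultimately show ?thesis by blast
  qed
  moreover have "b $ i \<in> (+) (b $ i) ` frac_ideal (k - l)" for i
    by (intro image_eqI[of _ _ 0]) auto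
  ultimately show "\<exists>A. (\<forall>i. open (A i) \<and> b $ i \<in> A i) \<and> (\<forall>y. (\<forall>i. y $ i \<in> A i) \<longrightarrow> y \<in> ?S)"
    by (intro exI[of _ "\<lambda>i. (+) (b $ i) ` frac_ideal (k - l)"]) (auto simp: open_add_frac_ideal)
qed

lemma open_convex_body:
  assumes "invertible g" shows "open (convex_body g)"
  using open_translate_image_frac_ideal[OF assms, of 0 0] by (simp add: convex_body_eq)

lemma invertible_mult_diag_X:
  "invertible (g :: 'a::{finite,field} fls ^ 'n ^ 'n::finite) \<Longrightarrow> invertible (g ** diag_X i)"
  by (simp add: invertible_det_nz det_mul det_diag_X)

text \<open>The body is a disjoint union of q translates of the smaller body, and \<open>m\<close>
  is translation invariant; openness supplies measurability.\<close>

lemma haar_diag_X: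
  fixes g :: "'a::{finite,field} fls ^ 'n ^ 'n::finite"
  assumes m: "normalized_haar m" and g: "invertible g"
  shows "emeasure m (convex_body g) = of_nat CARD('a) * emeasure m (convex_body (g ** diag_X i))"
proof -
  let ?F = "\<lambda>c. (+) (g *v axis i (fls_const c)) ` convex_body (g ** diag_X i)"
  have sets: "sets m = sets borel"
    and inv: "\<And>v A. A \<in> sets m \<Longrightarrow> emeasure m ((+) v ` A) = emeasure m A"
    using m by (auto simp: normalized_haar_def)
  have "open (?F c)" for c
    unfolding convex_body_eq by (rule open_translate_image_frac_ideal[OF invertible_mult_diag_X[OF g]])
  then have "emeasure m (\<Union>c\<in>UNIV. ?F c) = (\<Sum>c\<in>UNIV. emeasure m (?F c))"
    using convex_body_diag_X_cosets(2)[OF g] sets by (intro sum_emeasure[symmetric]) auto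
  also have "\<dots> = (\<Sum>c\<in>(UNIV :: 'a set). emeasure m (convex_body (g ** diag_X i)))"
    using open_convex_body[OF invertible_mult_diag_X[OF g]] sets by (intro sum.cong inv) auto
  finally show ?thesis
    using convex_body_diag_X_cosets(1)[OF g] by simp
qed

section \<open>Haar measure as the absolute value of the determinant\<close>

lemma fls_abs_mult: "fls_abs (f * f') = fls_abs f * fls_abs f'"
  by (auto simp: fls_abs_def power_int_diff power_int_minus field_simps power_int_add)

lemma fls_abs_X: "fls_abs (fls_X :: 'a::{finite,field} fls) = 1 / real CARD('a)"
  by (simp add: fls_abs_def power_int_minus divide_inverse)

lemma fls_abs_pos: "f \<noteq> 0 \<Longrightarrow> fls_abs f > 0"
  by (simp add: fls_abs_def)

lemma fls_abs_nonneg: "fls_abs f \<ge> 0"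
  by (simp add: fls_abs_def)

text \<open>Measure and absolute determinant both drop by the factor q, which cancels in
  \<open>ennreal\<close>. Integral matrices use the implication from left to right, clearing
  denominators uses the converse.\<close>

lemma haar_diag_X_abs:
  fixes g :: "'a::{finite,field} fls ^ 'n ^ 'n::finite"
  assumes m: "normalized_haar m" and g: "invertible g"
  shows "emeasure m (convex_body g) = ennreal (fls_abs (det g))
    \<longleftrightarrow> emeasure m (convex_body (g ** diag_X i)) = ennreal (fls_abs (det (g ** diag_X i)))"
proof -
  have "ennreal (fls_abs (det g)) = of_nat CARD('a) * ennreal (fls_abs (det (g ** diag_X i)))"
    by (simp add: det_mul det_diag_X fls_abs_mult fls_abs_X fls_abs_nonneg
        ennreal_of_nat_eq_real_of_nat flip: ennreal_mult)
  then show ?thesis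
    unfolding haar_diag_X[OF m g, of i] by (simp add: ennreal_mult_cancel_left)
qed

text \<open>If the reduction modulo \<open>X\<close> of an integral matrix \<open>g\<close> kills \<open>c\<close>, then a unimodular column
  operation replaces column \<open>i\<close> of \<open>g\<close> by \<open>g c\<close>, which is divisible by \<open>X\<close>.\<close>

lemma haar_integral:
  fixes g :: "'a::{finite,field} fls ^ 'n ^ 'n::finite"
  assumes m: "normalized_haar m"
  shows "(\<And>i j. g $ i $ j \<in> frac_ideal 0) \<Longrightarrow> det g \<noteq> 0 \<Longrightarrow>
    emeasure m (convex_body g) = ennreal (fls_abs (det g))"
\<comment> \<open>Each extracted factor \<open>diag_X i\<close> lowers the subdegree of the
  determinant by one; once the determinant is a unit, the body is O^d, of measure 1.\<close>
proof (induction "nat (fls_subdegree (det g))" arbitrary: g rule: less_induct)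
  case (less g)
  have detg: "det g \<in> frac_ideal 0" "det g $$ 0 = det (\<chi> i j. g $ i $ j $$ 0)"
    using det_frac_ideal[of g] less.prems by auto
  show ?case
  proof (cases "det g $$ 0 = 0")
    case False
    then have "convex_body g = vecs (frac_ideal 0)"
      using unimodular_image[of g] less.prems by (simp add: convex_body_eq)
    moreover have "fls_subdegree (det g) = 0"
      using False detg by (intro fls_subdegree_eqI) (auto simp: frac_ideal_def)
    ultimately show ?thesis
      using m less.prems by (simp add: normalized_haar_def int_ring_eq fls_abs_def)
  next
    case True
    then have "\<not> invertible (\<chi> i j. g $ i $ j $$ 0)"
      using detg by (simp add: invertible_det_nz)
    then obtain c where c: "(\<chi> i j. g $ i $ j $$ 0) *v c = 0" "c \<noteq> 0"
      using matrix_left_invertible_ker[of "\<chi> i j. g $ i $ j $$ 0"]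
      by (auto simp: invertible_left_inverse)
    then obtain i where i: "c $ i \<noteq> 0" by (auto simp: vec_eq_iff)
    define c' where "c' = (\<chi> j. fls_const (c $ j))"
    define k :: "'a fls ^ 'n ^ 'n" where "k = (\<chi> r s. if s = i then c' $ r else mat 1 $ r $ s)"
    have k: "k $ r $ s \<in> frac_ideal 0" for r s
      by (auto simp: k_def c'_def mat_def frac_ideal_def)
    \<comment> \<open>\<open>k\<close> is the identity with column \<open>i\<close> replaced by
      \<open>c'\<close>, so its determinant is the constant \<open>c $ i\<close>, a unit by the
      choice of \<open>i\<close>.\<close>
    have detk: "det k = fls_const (c $ i)"
      using cramer_lemma[of i "mat 1" c']
      unfolding matrix_vector_mul_lid det_I by (simp add: k_def) (simp add: c'_def)
    have gk: "(g ** k) $ r $ s = (if s = i then (g *v c') $ r else g $ r $ s)" for r s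
    proof -
      have "(g ** k) $ r $ s = (g ** mat 1) $ r $ s" if "s \<noteq> i"
        using that unfolding matrix_matrix_mult_def by (simp add: k_def)
      moreover have "(g ** k) $ r $ i = (g *v c') $ r"
        by (simp add: matrix_matrix_mult_def matrix_vector_mult_def k_def)
      ultimately show ?thesis by simp
    qed
    have gc: "(g *v c') $ r \<in> frac_ideal 1" for r
    proof -
      have "(g *v c') $ r \<in> frac_ideal 0"
        using matrix_vector_mult_frac_ideal[of g 0 c' 0] less.prems
        by (auto simp: vecs_def c'_def frac_ideal_def)
      moreover have "(g *v c') $ r $$ 0 = ((\<chi> i j. g $ i $ j $$ 0) *v c) $ r"
        by (simp add: matrix_vector_mult_def fls_nth_sum c'_def)
      ultimately have "(g *v c') $ r $$ n = 0" if "n < 1" for n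
        using c that by (cases "n = 0") (auto simp: frac_ideal_def)
      then show ?thesis by (simp add: frac_ideal_def)
    qed
    define g' where "g' = (\<chi> r s. if s = i then fls_shift 1 ((g *v c') $ r) else g $ r $ s)"
    have gk': "g ** k = g' ** diag_X i"
      by (simp add: vec_eq_iff gk matrix_mult_diag_X g'_def fls_X_times_conv_shift)
    have g': "g' $ r $ s \<in> frac_ideal 0" for r s
      using gc[of r] less.prems by (auto simp: g'_def frac_ideal_def)
    have det_eq: "det g * fls_const (c $ i) = det g' * fls_X"
      using arg_cong[OF gk', of det] by (simp add: det_mul detk det_diag_X)
    have g'nz: "det g' \<noteq> 0"
      using det_eq less.prems i by auto
    have "fls_subdegree (det g) = fls_subdegree (det g') + 1"
      using arg_cong[OF det_eq, of fls_subdegree] less.prems i g'nz by simp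
    moreover have "fls_subdegree (det g') \<ge> 0"
      using det_frac_ideal(1)[OF g'] g'nz by (simp add: frac_ideal_iff_subdegree)
    ultimately have "emeasure m (convex_body g') = ennreal (fls_abs (det g'))"
      using less.hyps[of g'] g' g'nz by simp
    then have "emeasure m (convex_body (g ** k)) = ennreal (fls_abs (det (g ** k)))"
      using haar_diag_X_abs[OF m, of g' i] g'nz by (simp add: gk' invertible_det_nz)
    then show ?thesis
      using convex_body_mult_unimodular[OF k] i
      by (simp add: det_mul detk fls_abs_mult) (simp add: fls_abs_def)
  qed
qed

text \<open>Denominators are cleared by multiplying all columns by \<open>fls_X\<close>, repeatedly.
  Each such column operation preserves the validity of the formula in both directions, so the
  integral case suffices.\<close>

lemma haar_convex_body:
  fixes g :: "'a::{finite,field} fls ^ 'n ^ 'n::finite"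
  assumes m: "normalized_haar m" and g: "invertible g"
  shows "emeasure m (convex_body g) = ennreal (fls_abs (det g))"
proof -
  obtain k where k: "\<And>i j. g $ i $ j \<in> frac_ideal k"
    using matrix_entries_frac_ideal by metis
  have "emeasure m (convex_body g) = ennreal (fls_abs (det g))"
    if "\<And>i j. g $ i $ j \<in> frac_ideal (- int n)" "invertible g" for n and g :: "'a fls ^ 'n ^ 'n"
    using that
  proof (induction n arbitrary: g)
    case 0
    then show ?case
      using haar_integral[OF m, of g] by (simp add: invertible_det_nz)
  next
    case (Suc n)
    \<comment> \<open>\<open>M I\<close> has the columns in \<open>I\<close> scaled by
      \<open>fls_X\<close>; adding one index to \<open>I\<close> amounts to one factor
      \<open>diag_X i\<close>.\<close>
    define M where "M I = (\<chi> r s. if s \<in> I then g $ r $ s * fls_X else g $ r $ s)" for I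
    have step: "M (insert i I) = M I ** diag_X i" if "i \<notin> I" for i I
      using that by (simp add: M_def vec_eq_iff matrix_mult_diag_X)
    have M: "invertible (M I) \<and> (emeasure m (convex_body g) = ennreal (fls_abs (det g))
        \<longleftrightarrow> emeasure m (convex_body (M I)) = ennreal (fls_abs (det (M I))))" for I
      using finite[of I]
    proof (induction I rule: finite_induct)
      case empty
      show ?case using Suc.prems by (simp add: M_def)
    next
      case (insert i I)
      then show ?case
        using haar_diag_X_abs[OF m, of "M I" i] by (simp add: step invertible_mult_diag_X)
    qed
    have "M UNIV $ r $ s \<in> frac_ideal (- int n)" for r s
      using frac_ideal_shift[of "g $ r $ s" "- int (Suc n)"] Suc.prems(1)[of r s]
      by (simp add: M_def mult.commute)
    then show ?case
      using Suc.IH[of "M UNIV"] M[of UNIV] by simp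
  qed
  moreover have "g $ i $ j \<in> frac_ideal (- int (nat (- k)))" for i j
    by (rule subsetD[OF frac_ideal_antimono k]) simp
  ultimately show ?thesis using g by blast
qed

section \<open>Balls and leading coefficients\<close>

text \<open>The index is a valuation: the radius is \<open>q\<^sup>-\<^sup>k\<close>, so the balls shrink as \<open>k\<close> grows.\<close>

definition body_ball :: "'a::{finite,field} fls ^ 'n ^ 'n \<Rightarrow> int \<Rightarrow> ('a fls ^ 'n::finite) set" where
  "body_ball h k = {v. matrix_inv h *v v \<in> vecs (frac_ideal k)}"

lemma body_ball_eq_image:
  assumes "invertible h" shows "body_ball h k = (*v) h ` vecs (frac_ideal k)"
proof (intro equalityI subsetI)
  fix v assume "v \<in> body_ball h k"
  then show "v \<in> (*v) h ` vecs (frac_ideal k)"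
    by (intro image_eqI[of _ _ "matrix_inv h *v v"])
       (simp_all add: body_ball_def matrix_inv_cancel[OF assms])
qed (auto simp: body_ball_def matrix_inv_cancel[OF assms])

lemma body_ball_add: "v \<in> body_ball h k \<Longrightarrow> w \<in> body_ball h k \<Longrightarrow> v + w \<in> body_ball h k"
  by (simp add: body_ball_def matrix_vector_right_distrib vecs_frac_ideal_add)

lemma body_ball_diff: "v \<in> body_ball h k \<Longrightarrow> w \<in> body_ball h k \<Longrightarrow> v - w \<in> body_ball h k"
  by (simp add: body_ball_def matrix_vector_mult_diff_distrib vecs_frac_ideal_diff)

lemma body_ball_antimono: "k \<le> k' \<Longrightarrow> body_ball h k' \<subseteq> body_ball h k"
  using frac_ideal_antimono[of k k'] by (auto simp: body_ball_def vecs_def)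

lemma body_norm_le_iff:
  fixes h :: "'a::{finite,field} fls ^ 'n ^ 'n::finite"
  shows "body_norm h v \<le> real CARD('a) powi (- k) \<longleftrightarrow> v \<in> body_ball h k"
  by (simp add: body_norm_def fls_abs_le_iff body_ball_def vecs_def)

section \<open>Counting points by leading coefficients\<close>

lemma card_span_le:
  fixes B :: "('a::{finite,field} ^ 'n::finite) set"
  assumes "finite B" shows "card (vec.span B) \<le> CARD('a) ^ card B"
proof -
  have "vec.span B = (\<lambda>u. \<Sum>b\<in>B. u b *s b) ` (B \<rightarrow>\<^sub>E UNIV)"
  proof (intro equalityI subsetI)
    fix x assume "x \<in> vec.span B"
    then obtain u where "x = (\<Sum>b\<in>B. u b *s b)"
      by (auto simp: vec.span_finite[OF assms])
    then show "x \<in> (\<lambda>u. \<Sum>b\<in>B. u b *s b) ` (B \<rightarrow>\<^sub>E UNIV)"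
      by (intro image_eqI[of _ _ "restrict u B"]) auto
  qed (auto simp: vec.span_finite[OF assms])
  then have "card (vec.span B) \<le> card (B \<rightarrow>\<^sub>E (UNIV :: 'a set))"
    using assms by (simp add: card_image_le finite_PiE)
  then show ?thesis
    by (simp add: card_PiE[OF assms])
qed

text \<open>Scaling a nontrivial linear relation between the lifts so that its coefficients become integral
  and not all reduce to zero, and taking leading coefficients, gives a relation over the
  residue field.\<close>

lemma independent_lift:
  fixes B :: "('a::{finite,field} ^ 'n::finite) set" and h :: "'a fls ^ 'n ^ 'n"
  assumes B: "vec.independent B"
    and ball: "\<And>b. b \<in> B \<Longrightarrow> s b \<in> body_ball h k"
    and lead: "\<And>b i. b \<in> B \<Longrightarrow> (matrix_inv h *v s b) $ i $$ k = b $ i"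
  shows "inj_on s B" and "vec.independent (s ` B)"
proof -
  show inj: "inj_on s B"
    using lead by (metis inj_onI vec_eq_iff)
  have fin: "finite B"
    using B by (rule vec.finiteI_independent)
  show "vec.independent (s ` B)"
  proof (rule vec.independent_if_scalars_zero, goal_cases)
    case 1
    show ?case using fin by simp
  next
    case (2 f x)
    define c where "c = (\<lambda>b. f (s b))"
    have sum0: "(\<Sum>b\<in>B. c b *s s b) = 0"
      using 2 by (simp add: sum.reindex[OF inj] c_def)
    have "c b = 0" if "b \<in> B" for b
    proof (rule ccontr)
      assume "c b \<noteq> 0"
      define C where "C = {b \<in> B. c b \<noteq> 0}"
      \<comment> \<open>The least valuation of a nonzero coefficient. Instead of dividing by the
        \<open>n\<close>-th power of \<open>fls_X\<close>, the relation is read off at index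
        \<open>n + k\<close>, where only the coefficients at \<open>n\<close> and \<open>k\<close>
        contribute.\<close>
      define n where "n = Min (fls_subdegree ` c ` C)"
      have C: "finite C" "C \<noteq> {}"
        using fin that \<open>c b \<noteq> 0\<close> by (auto simp: C_def)
      have cn: "c b \<in> frac_ideal n" if "b \<in> B" for b
      proof (cases "c b = 0")
        case False
        then have "b \<in> C" using that by (simp add: C_def)
        then have "n \<le> fls_subdegree (c b)"
          unfolding n_def using C(1) by (intro Min_le) auto
        then show ?thesis by (simp add: frac_ideal_iff_subdegree)
      qed simp
      have "n \<in> fls_subdegree ` c ` C"
        unfolding n_def using C by (intro Min_in) auto
      then obtain b0 where b0: "b0 \<in> B" "c b0 \<noteq> 0" "n = fls_subdegree (c b0)"
        by (auto simp: C_def)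
      have "(\<Sum>b\<in>B. (c b $$ n) *s b) = 0"
      proof (simp only: vec_eq_iff, intro allI)
        fix i
        have "0 = (matrix_inv h *v (\<Sum>b\<in>B. c b *s s b)) $ i $$ (n + k)"
          by (simp add: sum0)
        also have "\<dots> = (\<Sum>b\<in>B. (c b * (matrix_inv h *v s b) $ i) $$ (n + k))"
          by (simp add: vec.linear_sum[OF matrix_vector_mul_linear_gen] vector_scalar_commute fls_nth_sum)
        also have "\<dots> = (\<Sum>b\<in>B. (c b $$ n) * b $ i)"
          using ball cn lead
          by (intro sum.cong refl) (subst nth_mult_frac_ideal, auto simp: body_ball_def vecs_def)
        finally show "(\<Sum>b\<in>B. (c b $$ n) *s b) $ i = 0 $ i"
          by simp
      qed
      then have "c b0 $$ n = 0"
        using vec.independentD[OF B fin subset_refl, of "\<lambda>b. c b $$ n" b0] b0(1) by simp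
      then show False using b0 by simp
    qed
    then show ?case using 2 by (auto simp: c_def)
  qed
qed

text \<open>The map \<open>\<rho>\<close> to the coefficients at index \<open>k\<close> is additive,
  so two points of a fibre differ by an element of the next ball. The number of fibres is bounded
  through \<open>independent_lift\<close>.\<close>

lemma card_Int_body_ball_le:
  fixes h :: "'a::{finite,field} fls ^ 'n ^ 'n::finite"
  assumes fin: "finite (S \<inter> body_ball h k)"
    and diff: "\<And>v w. v \<in> S \<Longrightarrow> w \<in> S \<Longrightarrow> v - w \<in> S"
  shows "card (S \<inter> body_ball h k)
    \<le> card (S \<inter> body_ball h (k + 1)) * CARD('a) ^ vec.dim (S \<inter> body_ball h k)"
proof -
  define T where "T = S \<inter> body_ball h k"
  define \<rho> where "\<rho> = (\<lambda>v. \<chi> i. (matrix_inv h *v v) $ i $$ k)"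
  have fibre: "card {v \<in> T. \<rho> v = w} \<le> card (S \<inter> body_ball h (k + 1))" if "w \<in> \<rho> ` T" for w
  proof -
    obtain v0 where v0: "v0 \<in> T" "w = \<rho> v0" using \<open>w \<in> \<rho> ` T\<close> by blast
    have "v - v0 \<in> S \<inter> body_ball h (k + 1)" if v: "v \<in> T" "\<rho> v = w" for v
    proof
      show "v - v0 \<in> S" using v v0 diff by (auto simp: T_def)
      have "(matrix_inv h *v v - matrix_inv h *v v0) $ i $$ n = 0" if "n < k + 1" for i n
      proof (cases "n = k")
        case True
        then show ?thesis using v v0 by (simp add: \<rho>_def vec_eq_iff)
      next
        case False
        then show ?thesis
          using v v0 that by (auto simp: T_def body_ball_def vecs_def frac_ideal_def)
      qed
      then show "v - v0 \<in> body_ball h (k + 1)"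
        by (simp add: body_ball_def vecs_def frac_ideal_def matrix_vector_mult_diff_distrib)
    qed
    moreover have "finite (S \<inter> body_ball h (k + 1))"
      by (rule finite_subset[OF _ fin]) (use body_ball_antimono[of k "k + 1" h] in auto)
    ultimately show ?thesis
      by (intro card_inj_on_le[where f = "\<lambda>v. v - v0"]) (auto simp: inj_on_def)
  qed
  have "T = (\<Union>w\<in>\<rho> ` T. {v \<in> T. \<rho> v = w})" by auto
  then have "card T \<le> (\<Sum>w\<in>\<rho> ` T. card {v \<in> T. \<rho> v = w})"
    using card_UN_le[of "\<rho> ` T" "\<lambda>w. {v \<in> T. \<rho> v = w}"] fin by (simp add: T_def)
  also have "\<dots> \<le> card (\<rho> ` T) * card (S \<inter> body_ball h (k + 1))"
    using sum_bounded_above[of "\<rho> ` T", OF fibre] by simp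
  also have "card (\<rho> ` T) \<le> CARD('a) ^ vec.dim T"
  proof -
    \<comment> \<open>The image is counted inside its linear span; a basis chosen within the image
      has lifts in \<open>T\<close>, which are again independent.\<close>
    obtain B where B: "B \<subseteq> \<rho> ` T" "vec.independent B" "\<rho> ` T \<subseteq> vec.span B"
      using vec.maximal_independent_subset[of "\<rho> ` T"] by blast
    have finB: "finite B" using B(2) by (rule vec.finiteI_independent)
    define s where "s = inv_into T \<rho>"
    have s: "s b \<in> T" "\<rho> (s b) = b" if "b \<in> B" for b
      using B that by (auto simp: s_def inv_into_into f_inv_into_f)
    have ball: "s b \<in> body_ball h k" if "b \<in> B" for b
      using s(1)[OF that] by (simp add: T_def)
    have lead: "(matrix_inv h *v s b) $ i $$ k = b $ i" if "b \<in> B" for b i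
      using s(2)[OF that] by (simp add: \<rho>_def vec_eq_iff)
    note ind = independent_lift[OF B(2) ball lead]
    have "card B = card (s ` B)"
      using ind(1) by (simp add: card_image)
    also have "\<dots> \<le> vec.dim T"
      using s ind(2) by (intro vec.independent_card_le_dim) auto
    finally have "card B \<le> vec.dim T" .
    moreover have "card (\<rho> ` T) \<le> card (vec.span B)"
      using B(3) by (intro card_mono) auto
    moreover note card_span_le[OF finB]
    moreover have "CARD('a) ^ card B \<le> CARD('a) ^ vec.dim T" if "card B \<le> vec.dim T"
      using that by (intro power_increasing) auto
    ultimately show ?thesis by linarith
  qed
  finally show ?thesis by (simp add: T_def mult.commute)
qed

section \<open>Periodic lattices\<close>

text \<open>The entries of \<open>matrix_inv h ** g\<close> lie in a common ideal. The purpose is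
  that large balls contain the fundamental domain and the lattice basis given by the columns of
  \<open>g\<close>.\<close>

lemma image_frac_ideal_0_subset_body_ball:
  fixes g h :: "'a::{finite,field} fls ^ 'n ^ 'n::finite"
  obtains K where "\<And>k. k \<le> K \<Longrightarrow> (*v) g ` vecs (frac_ideal 0) \<subseteq> body_ball h k"
proof -
  obtain K where K: "\<And>i j. (matrix_inv h ** g) $ i $ j \<in> frac_ideal K"
    using matrix_entries_frac_ideal by metis
  have "(*v) g ` vecs (frac_ideal 0) \<subseteq> body_ball h K"
    using matrix_vector_mult_frac_ideal[OF K, of _ 0]
    by (auto simp: body_ball_def matrix_vector_mul_assoc)
  then show ?thesis
    using body_ball_antimono[of _ K h] that by blast
qed

text \<open>In the coordinates of \<open>g\<close> these points are polynomial vectors of bounded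
  degree.\<close>

lemma finite_lattice_Int_body_ball:
  fixes g h :: "'a::{finite,field} fls ^ 'n ^ 'n::finite"
  assumes g: "invertible g" and h: "invertible h"
  shows "finite (lattice g \<inter> body_ball h k)"
proof -
  obtain l where l: "\<And>i j. (matrix_inv g ** h) $ i $ j \<in> frac_ideal l"
    using matrix_entries_frac_ideal by metis
  have "lattice g \<inter> body_ball h k \<subseteq> (*v) g ` vecs (polys \<inter> frac_ideal (l + k))"
  proof
    fix v assume v: "v \<in> lattice g \<inter> body_ball h k"
    then obtain p where p: "p \<in> vecs polys" "v = g *v p"
      by (auto simp: lattice_def)
    obtain w where w: "w \<in> vecs (frac_ideal k)" "v = h *v w"
      using v by (auto simp: body_ball_eq_image[OF h])
    have "p = (matrix_inv g ** h) *v w"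
      using p w by (metis matrix_inv_cancel(1)[OF g] matrix_vector_mul_assoc)
    then have "p \<in> vecs (frac_ideal (l + k))"
      using matrix_vector_mult_frac_ideal[OF l w(1)] by simp
    then show "v \<in> (*v) g ` vecs (polys \<inter> frac_ideal (l + k))"
      using p by (auto simp: vecs_def)
  qed
  then show ?thesis
    by (rule finite_subset) (intro finite_imageI finite_vecs finite_polys_Int_frac_ideal)
qed

lemma lattice_plus_fund_domain:
  fixes g :: "'a::{finite,field} fls ^ 'n ^ 'n::finite"
  assumes g: "invertible g"
  obtains l r where "l \<in> lattice g" "r \<in> fund_domain g" "v = l + r"
proof -
  have "\<exists>p r. p \<in> polys \<and> r \<in> frac_ideal 1 \<and> (matrix_inv g *v v) $ i = p + r" for i
    by (metis polys_plus_frac_ideal)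
  then obtain p r where pr: "\<And>i. p i \<in> polys" "\<And>i. r i \<in> frac_ideal 1"
    "\<And>i. (matrix_inv g *v v) $ i = p i + r i"
    by metis
  have "matrix_inv g *v v = (\<chi> i. p i) + (\<chi> i. r i)"
    by (simp add: vec_eq_iff pr(3))
  then have "v = g *v (\<chi> i. p i) + g *v (\<chi> i. r i)"
    by (metis matrix_inv_cancel(2)[OF g] matrix_vector_right_distrib)
  then show thesis
    using pr by (intro that[of "g *v (\<chi> i. p i)" "g *v (\<chi> i. r i)"])
      (auto simp: lattice_def fund_domain_eq vecs_def)
qed

lemma lattice_diff: "v \<in> lattice g \<Longrightarrow> w \<in> lattice g \<Longrightarrow> v - w \<in> lattice g"
  by (auto simp: lattice_def vecs_def polys_diff simp flip: matrix_vector_mult_diff_distrib intro!: imageI)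

lemma fund_domain_diff: "v \<in> fund_domain g \<Longrightarrow> w \<in> fund_domain g \<Longrightarrow> v - w \<in> fund_domain g"
  by (auto simp: fund_domain_eq simp flip: matrix_vector_mult_diff_distrib intro!: imageI vecs_frac_ideal_diff)

lemma lattice_Int_fund_domain:
  assumes "invertible g" "v \<in> lattice g" "v \<in> fund_domain g"
  shows "v = 0"
proof -
  obtain p r where pr: "p \<in> vecs polys" "r \<in> vecs (frac_ideal 1)" "v = g *v p" "v = g *v r"
    using assms by (auto simp: lattice_def fund_domain_eq)
  then have "p = r"
    using invertible_mult_eq_iff[OF assms(1)] by auto
  then have "p $ i \<in> polys \<inter> frac_ideal 1" for i
    using pr by (auto simp: vecs_def)
  then have "p = 0"
    by (simp add: vec_eq_iff polys_Int_frac_ideal)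
  then show ?thesis using pr by simp
qed

lemma fund_domain_subset_image: "fund_domain g \<subseteq> (*v) g ` vecs (frac_ideal 0)"
  using frac_ideal_antimono[of 0 1] by (auto simp: fund_domain_eq vecs_def)

text \<open>With \<open>c\<close> the \<open>k\<close>-th power of \<open>fls_X\<close>, the set is
  the convex body of \<open>g ** mat c\<close>, and the scalar matrix contributes
  \<open>c ^ CARD('n)\<close> to the determinant.\<close>

lemma emeasure_image_frac_ideal:
  fixes g :: "'a::{finite,field} fls ^ 'n ^ 'n::finite"
  assumes m: "normalized_haar m" and g: "invertible g"
  shows "emeasure m ((*v) g ` vecs (frac_ideal k))
    = ennreal (fls_abs (det g) * real CARD('a) powi (- k * int CARD('n)))"
proof -
  define c where "c = (fls_shift (- k) 1 :: 'a fls)"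
  have c: "c \<noteq> 0" "fls_subdegree c = k"
    by (simp_all add: c_def)
  have det: "det (mat c :: 'a fls ^ 'n ^ 'n) = c ^ CARD('n)"
    by (subst det_diagonal) (simp_all add: mat_def)
  have "invertible (g ** mat c)"
    using g c by (simp add: invertible_det_nz det_mul det)
  moreover have "(*v) g ` vecs (frac_ideal k) = convex_body (g ** mat c)"
  proof -
    have mat: "mat c *v w = (\<chi> i. c * w $ i)" for w :: "'a fls ^ 'n"
      by (simp add: vec_eq_iff matrix_vector_mult_def mat_def if_distrib[of "\<lambda>x. x * _"] cong: if_cong)
    have "vecs (frac_ideal k) = (*v) (mat c :: 'a fls ^ 'n ^ 'n) ` vecs (frac_ideal 0)"
    proof (intro equalityI subsetI)
      fix v :: "'a fls ^ 'n" assume v: "v \<in> vecs (frac_ideal k)"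
      have "v = mat c *v (\<chi> i. fls_shift k (v $ i))"
        unfolding mat by (simp add: vec_eq_iff c_def fls_X_intpow_times_conv_shift)
      moreover have "(\<chi> i. fls_shift k (v $ i)) \<in> vecs (frac_ideal 0)"
        using v by (simp add: vecs_def frac_ideal_def)
      ultimately show "v \<in> (*v) (mat c) ` vecs (frac_ideal 0)" by blast
    next
      fix v :: "'a fls ^ 'n" assume "v \<in> (*v) (mat c) ` vecs (frac_ideal 0)"
      moreover have "c \<in> frac_ideal k" using c by (simp add: frac_ideal_iff_subdegree)
      ultimately show "v \<in> vecs (frac_ideal k)"
        using frac_ideal_mult[of c k _ 0] by (auto simp: mat vecs_def)
    qed
    then show ?thesis
      by (simp add: convex_body_eq image_image matrix_vector_mul_assoc)
  qed
  moreover have "fls_abs (c ^ n) = real CARD('a) powi (- k * int n)" for n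
    using c by (simp add: fls_abs_def fls_subdegree_pow mult.commute)
  ultimately show ?thesis
    using haar_convex_body[OF m, of "g ** mat c"] by (simp add: det_mul det fls_abs_mult)
qed

text \<open>Write \<open>v = l + r\<close> with \<open>r\<close> in the fundamental domain. The ball
  is a group containing \<open>r\<close>, so it contains \<open>l\<close> too; hence the translates
  by lattice points of the ball already cover it.\<close>

lemma emeasure_body_ball_le:
  fixes g h :: "'a::{finite,field} fls ^ 'n ^ 'n::finite"
  assumes m: "normalized_haar m" and g: "invertible g" and h: "invertible h"
    and sub: "fund_domain g \<subseteq> body_ball h k"
  shows "emeasure m (body_ball h k)
    \<le> of_nat (card (lattice g \<inter> body_ball h k)) * emeasure m (fund_domain g)"
proof -
  let ?L = "lattice g \<inter> body_ball h k"
  have sets: "sets m = sets borel"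
    and inv: "\<And>v A. A \<in> sets m \<Longrightarrow> emeasure m ((+) v ` A) = emeasure m A"
    using m by (auto simp: normalized_haar_def)
  have meas: "(+) l ` fund_domain g \<in> sets m" for l
    using open_translate_image_frac_ideal[OF g] by (simp add: sets fund_domain_eq)
  have "body_ball h k \<subseteq> (\<Union>l\<in>?L. (+) l ` fund_domain g)"
  proof
    fix v assume v: "v \<in> body_ball h k"
    obtain l r where lr: "l \<in> lattice g" "r \<in> fund_domain g" "v = l + r"
      using lattice_plus_fund_domain[OF g] by metis
    then have "l = v - r" by simp
    then have "l \<in> body_ball h k"
      using v lr sub body_ball_diff[of v h k r] by auto
    then show "v \<in> (\<Union>l\<in>?L. (+) l ` fund_domain g)"
      using lr by auto
  qed
  then have "emeasure m (body_ball h k) \<le> emeasure m (\<Union>l\<in>?L. (+) l ` fund_domain g)"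
    using meas finite_lattice_Int_body_ball[OF g h] by (intro emeasure_mono sets.finite_UN) auto
  also have "\<dots> \<le> (\<Sum>l\<in>?L. emeasure m ((+) l ` fund_domain g))"
    using meas finite_lattice_Int_body_ball[OF g h] by (intro emeasure_subadditive_finite) auto
  also have "\<dots> = (\<Sum>l\<in>?L. emeasure m (fund_domain g))"
    using meas[of 0] by (intro sum.cong inv) auto
  finally show ?thesis by simp
qed

lemma periodic_lattice_diff:
  assumes "periodic_lattice g N S" "v \<in> S" "w \<in> S" shows "v - w \<in> S"
proof -
  interpret vector_space "\<lambda>(c::'a::{finite,field}) (v::'a fls ^ 'n::finite). fls_const c *s v"
    by (rule vector_space_const_scale)
  show ?thesis
    using assms by (auto simp: periodic_lattice_def intro: subspace_diff)
qed

lemma periodic_lattice_zero: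
  assumes "periodic_lattice g N S" shows "0 \<in> S"
proof -
  interpret vector_space "\<lambda>(c::'a::{finite,field}) (v::'a fls ^ 'n::finite). fls_const c *s v"
    by (rule vector_space_const_scale)
  show ?thesis
    using assms by (auto simp: periodic_lattice_def intro: subspace_0)
qed

lemma periodic_lattice_add_lattice:
  assumes "periodic_lattice g N S" "l \<in> lattice g" "v \<in> S" shows "l + v \<in> S"
  using assms unfolding periodic_lattice_def by blast

lemma lattice_subset_periodic_lattice:
  assumes "periodic_lattice g N S" shows "lattice g \<subseteq> S"
  using periodic_lattice_add_lattice[OF assms _ periodic_lattice_zero[OF assms]] by auto

text \<open>The splitting \<open>v = l + r\<close> restricts to a bijection: the ball is a group
  containing the fundamental domain, hence contains \<open>l\<close>, and \<open>S\<close> is a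
  group containing the lattice, hence contains \<open>r\<close>. Uniqueness comes from
  \<open>lattice_Int_fund_domain\<close>.\<close>

lemma periodic_lattice_Int_body_ball:
  fixes g h :: "'a::{finite,field} fls ^ 'n ^ 'n::finite"
  assumes S: "periodic_lattice g N S" and g: "invertible g" and h: "invertible h"
    and sub: "fund_domain g \<subseteq> body_ball h k"
  shows "finite (S \<inter> body_ball h k)"
    and "card (S \<inter> body_ball h k) = card (lattice g \<inter> body_ball h k) * CARD('a) ^ N"
proof -
  let ?P = "(lattice g \<inter> body_ball h k) \<times> (fund_domain g \<inter> S)"
  have card: "card (fund_domain g \<inter> S) = CARD('a) ^ N"
    using S by (simp add: periodic_lattice_def)
  \<comment> \<open>An infinite set has \<open>card\<close> 0, so the positive value
    \<open>CARD('a) ^ N\<close> forces finiteness.\<close>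
  then have fin: "finite ?P"
    using finite_lattice_Int_body_ball[OF g h] card_ge_0_finite[of "fund_domain g \<inter> S"] by auto
  have eq: "S \<inter> body_ball h k = (\<lambda>(l, r). l + r) ` ?P"
  proof (intro equalityI subsetI)
    fix v assume v: "v \<in> S \<inter> body_ball h k"
    obtain l r where lr: "l \<in> lattice g" "r \<in> fund_domain g" "v = l + r"
      using lattice_plus_fund_domain[OF g] by metis
    have "v - r \<in> body_ball h k" "v - l \<in> S"
      using v lr(1,2) sub lattice_subset_periodic_lattice[OF S]
      by (auto intro: body_ball_diff periodic_lattice_diff[OF S])
    then have "l \<in> body_ball h k" "r \<in> S"
      by (simp_all add: lr(3))
    then show "v \<in> (\<lambda>(l, r). l + r) ` ?P"
      using lr by auto
  next
    fix v assume "v \<in> (\<lambda>(l, r). l + r) ` ?P"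
    then obtain l r where lr: "l \<in> lattice g" "l \<in> body_ball h k" "r \<in> fund_domain g" "r \<in> S"
      "v = l + r" by auto
    then show "v \<in> S \<inter> body_ball h k"
      using sub periodic_lattice_add_lattice[OF S lr(1,4)] body_ball_add[of l h k r] by auto
  qed
  have inj: "inj_on (\<lambda>(l, r). l + r) ?P"
  proof (rule inj_onI, clarify)
    fix l r l' r'
    assume l: "l \<in> lattice g" "l' \<in> lattice g" and r: "r \<in> fund_domain g" "r' \<in> fund_domain g"
      and "l + r = l' + r'"
    then have "l - l' = r' - r" by (simp add: algebra_simps)
    then have "l - l' = 0"
      using lattice_diff[OF l] fund_domain_diff[OF r(2) r(1)]
      by (intro lattice_Int_fund_domain[OF g]) auto
    then show "l = l' \<and> r = r'"
      using \<open>l + r = l' + r'\<close> by simp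
  qed
  show "finite (S \<inter> body_ball h k)"
    using fin by (simp add: eq)
  show "card (S \<inter> body_ball h k) = card (lattice g \<inter> body_ball h k) * CARD('a) ^ N"
    unfolding eq card_image[OF inj] card_cartesian_product card ..
qed

section \<open>Successive minima\<close>

text \<open>0 and 1 are polynomials as well as integral, so the columns of \<open>g\<close> lie both
  in the lattice and in g O^d, and they span the whole space.\<close>

lemma dim_Int_body_ball_full:
  fixes g h :: "'a::{finite,field} fls ^ 'n ^ 'n::finite"
  assumes g: "invertible g" and sub: "(*v) g ` vecs (frac_ideal 0) \<subseteq> body_ball h k"
    and S: "lattice g \<subseteq> S"
  shows "vec.dim (S \<inter> body_ball h k) = CARD('n)"
proof -
  have "cart_basis \<subseteq> vecs polys \<inter> (vecs (frac_ideal 0) :: ('a fls ^ 'n) set)"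
    by (auto simp: cart_basis_def vecs_def axis_def polys_eq frac_ideal_def)
  then have "(*v) g ` cart_basis \<subseteq> lattice g" "(*v) g ` cart_basis \<subseteq> (*v) g ` vecs (frac_ideal 0)"
    by (auto simp: lattice_def)
  then have "(*v) g ` cart_basis \<subseteq> S \<inter> body_ball h k"
    using sub S by blast
  then have "vec.span ((*v) g ` cart_basis) \<subseteq> vec.span (S \<inter> body_ball h k)"
    by (rule vec.span_mono)
  moreover have "vec.span ((*v) g ` cart_basis) = (*v) g ` vec.span cart_basis"
    by (rule vec.linear_span_image[OF matrix_vector_mul_linear_gen])
  moreover have "surj ((*v) g)"
    using matrix_inv_cancel(2)[OF g] by (rule surjI)
  ultimately have "vec.span (S \<inter> body_ball h k) = UNIV"
    by auto
  then show ?thesis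
    by (metis vec.dim_span vec_dim_card)
qed

lemma body_ball_eventually_trivial:
  fixes h :: "'a::{finite,field} fls ^ 'n ^ 'n::finite"
  assumes h: "invertible h" and fin: "finite (S \<inter> body_ball h k0)"
  obtains K where "k0 \<le> K" "\<And>k. K \<le> k \<Longrightarrow> S \<inter> body_ball h k \<subseteq> {0}"
proof -
  \<comment> \<open>Beyond the largest valuation of a coordinate of these finitely many points, only
    zero coordinates remain. Inserting \<open>k0\<close> makes the maximum exist and be at least
    \<open>k0\<close>.\<close>
  define F where "F = insert k0 (
    (\<lambda>(v, i). fls_subdegree ((matrix_inv h *v v) $ i)) ` ((S \<inter> body_ball h k0) \<times> UNIV))"
  have F: "finite F" using fin by (simp add: F_def)
  then have "k0 \<le> Max F" by (simp add: F_def)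
  moreover have "v = 0" if k: "Max F + 1 \<le> k" and v: "v \<in> S" "v \<in> body_ball h k" for k v
  proof -
    have "v \<in> body_ball h k0"
      using v k \<open>k0 \<le> Max F\<close> body_ball_antimono[of k0 k h] by auto
    then have "fls_subdegree ((matrix_inv h *v v) $ i) \<in> F" for i
      using v by (force simp: F_def)
    then have "fls_subdegree ((matrix_inv h *v v) $ i) < k" for i
      using F k by (meson Max_ge le_less_trans zle_add1_eq_le less_le_trans linorder_not_le)
    then have "(matrix_inv h *v v) $ i = 0" for i
      using v by (auto simp: body_ball_def vecs_def frac_ideal_iff_subdegree not_le[symmetric])
    then have "matrix_inv h *v v = 0"
      by (simp add: vec_eq_iff)
    then show "v = 0"
      using matrix_inv_cancel(2)[OF h, of v] by simp
  qed
  ultimately show ?thesis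
    by (intro that[of "Max F + 1"]) auto
qed

text \<open>Iterates \<open>card_Int_body_ball_le\<close> downwards from \<open>K\<close>, where at
  most one point is left.\<close>

lemma card_Int_body_ball_le_power:
  fixes h :: "'a::{finite,field} fls ^ 'n ^ 'n::finite"
  assumes fin: "\<And>k. finite (S \<inter> body_ball h k)"
    and diff: "\<And>v w. v \<in> S \<Longrightarrow> w \<in> S \<Longrightarrow> v - w \<in> S"
    and triv: "S \<inter> body_ball h K \<subseteq> {0}" and "k \<le> K"
  shows "card (S \<inter> body_ball h k) \<le> CARD('a) ^ (\<Sum>j\<in>{k..<K}. vec.dim (S \<inter> body_ball h j))"
  using \<open>k \<le> K\<close>
proof (induction k rule: int_le_induct)
  case base
  show ?case using card_mono[OF _ triv] by simp
next
  case (step k)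
  let ?D = "\<lambda>j. vec.dim (S \<inter> body_ball h j)"
  have "card (S \<inter> body_ball h (k - 1)) \<le> card (S \<inter> body_ball h k) * CARD('a) ^ ?D (k - 1)"
    using card_Int_body_ball_le[of S h "k - 1"] fin diff by simp
  also have "\<dots> \<le> CARD('a) ^ (\<Sum>j\<in>{k..<K}. ?D j) * CARD('a) ^ ?D (k - 1)"
    using step by (intro mult_right_mono) auto
  also have "\<dots> = CARD('a) ^ (\<Sum>j\<in>{k - 1..<K}. ?D j)"
  proof -
    have "{k - 1..<K} = insert (k - 1) {k..<K}" using step by auto
    then show ?thesis by (simp add: power_add mult.commute)
  qed
  finally show ?case .
qed

text \<open>\<open>a i\<close> is the last index at which \<open>D\<close> is still at least
  \<open>i\<close>. For \<open>j \<ge> K\<close>, \<open>D j\<close> counts the \<open>i\<close>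
  with \<open>j \<le> a i\<close>, and interchanging the summations evaluates the sum, as for
  conjugate partitions.\<close>

lemma antimono_jumps:
  fixes D :: "int \<Rightarrow> nat"
  assumes D: "antimono D" and full: "\<And>k. k \<le> K \<Longrightarrow> D k = d" and zero: "\<And>k. K' \<le> k \<Longrightarrow> D k = 0"
  obtains a where "\<And>i k. i \<in> {1..d} \<Longrightarrow> i \<le> D k \<longleftrightarrow> k \<le> a i"
    "\<And>i. i \<in> {1..d} \<Longrightarrow> K \<le> a i"
    "int (\<Sum>j\<in>{K..<K'}. D j) = (\<Sum>i=1..d. a i - K + 1)"
proof -
  have "\<exists>a. \<forall>k. i \<le> D k \<longleftrightarrow> k \<le> a" if i: "i \<in> {1..d}" for i
  proof -
    let ?A = "{k \<in> {K..K'}. i \<le> D k}"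
    have "\<not> K' \<le> K"
      using zero[of K] full[of K] i by auto
    then have A: "finite ?A" "K \<in> ?A"
      using i full[of K] by (auto intro: finite_subset[of _ "{K..K'}"])
    have "Max ?A \<in> ?A"
      using A by (intro Max_in) auto
    have "i \<le> D k \<longleftrightarrow> k \<le> Max ?A" for k
    proof
      assume k: "i \<le> D k"
      show "k \<le> Max ?A"
      proof (cases "k < K")
        case True
        then show ?thesis using Max_ge[OF A] by linarith
      next
        case False
        then have "k \<in> ?A" using k zero[of k] i by force
        then show ?thesis using A by (intro Max_ge)
      qed
    next
      assume "k \<le> Max ?A"
      then have "D (Max ?A) \<le> D k" using D by (simp add: antimonoD)
      then show "i \<le> D k" using \<open>Max ?A \<in> ?A\<close> by simp
    qed
    then show ?thesis by blast
  qed
  then obtain a where a: "\<And>i k. i \<in> {1..d} \<Longrightarrow> i \<le> D k \<longleftrightarrow> k \<le> a i"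
    by metis
  have aK: "K \<le> a i" if "i \<in> {1..d}" for i
    using a[OF that, of K] that full[of K] by auto
  have aK': "a i < K'" if "i \<in> {1..d}" for i
    using a[OF that, of K'] that zero[of K'] by auto
  have "D j = card {i \<in> {1..d}. j \<le> a i}" if "K \<le> j" for j
  proof -
    have "D j \<le> d" using antimonoD[OF D that] full[of K] by simp
    then have "{i \<in> {1..d}. j \<le> a i} = {1..D j}"
      using a by fastforce
    then show ?thesis by simp
  qed
  then have "int (\<Sum>j\<in>{K..<K'}. D j) = (\<Sum>j\<in>{K..<K'}. \<Sum>i=1..d. if j \<le> a i then 1 else 0)"
    by (simp add: sum.If_cases Int_def)
  also have "\<dots> = (\<Sum>i=1..d. \<Sum>j\<in>{K..<K'}. if j \<le> a i then 1 else 0)"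
    by (rule sum.swap)
  also have "\<dots> = (\<Sum>i=1..d. a i - K + 1)"
  proof (rule sum.cong[OF refl])
    fix i assume i: "i \<in> {1..d}"
    \<comment> \<open>As \<open>a i < K'\<close>, nothing is cut off at the upper end; both end
      points count, whence the + 1.\<close>
    have "{K..<K'} \<inter> {j. j \<le> a i} = {K..a i}"
      using aK'[OF i] by auto
    then show "(\<Sum>j\<in>{K..<K'}. if j \<le> a i then 1 else 0) = a i - K + 1"
      using aK[OF i] by (simp add: sum.If_cases)
  qed
  finally show ?thesis
    using that a aK by blast
qed

section \<open>Real radii and powers of q\<close>

lemma power_int_sum:
  fixes q :: "'b::field"
  assumes "q \<noteq> 0" shows "q powi (\<Sum>i\<in>I. f i) = (\<Prod>i\<in>I. q powi f i)"
  by (induction I rule: infinite_finite_induct) (use assms in \<open>auto simp: power_int_add\<close>)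

lemma powi_floor:
  assumes "1 < q" "0 < (r::real)"
  obtains j :: int where "q powi j \<le> r" "r < q powi (j + 1)"
proof -
  define j where "j = \<lfloor>log q r\<rfloor>"
  have "q powr real_of_int j \<le> q powr log q r" "q powr log q r < q powr real_of_int (j + 1)"
    using assms(1) unfolding j_def by (intro powr_mono powr_less_mono; linarith)+
  then show ?thesis
    using assms by (intro that[of j]) (simp_all del: of_int_add flip: powr_real_of_int')
qed

text \<open>Norms are 0 or integer powers of q, so rounding \<open>r\<close> down to such a power
  leaves the ball unchanged.\<close>

lemma body_norm_ball:
  fixes h :: "'a::{finite,field} fls ^ 'n ^ 'n::finite"
  assumes "0 < r"
  obtains k where "{v. body_norm h v \<le> r} = body_ball h k" "real CARD('a) powi (- k) \<le> r"
proof -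
  obtain j where j: "real CARD('a) powi j \<le> r" "r < real CARD('a) powi (j + 1)"
    using powi_floor[OF card_field_gt_1 assms] by metis
  have "fls_abs f \<le> r \<longleftrightarrow> f \<in> frac_ideal (- j)" for f :: "'a fls"
  proof
    assume "fls_abs f \<le> r"
    show "f \<in> frac_ideal (- j)"
    proof (rule ccontr)
      assume "f \<notin> frac_ideal (- j)"
      then have "f \<noteq> 0" "j + 1 \<le> - fls_subdegree f"
        by (auto simp: frac_ideal_iff_subdegree)
      then have "real CARD('a) powi (j + 1) \<le> fls_abs f"
        using card_field_gt_1[where 'a='a] by (simp add: fls_abs_def power_int_increasing)
      then show False using \<open>fls_abs f \<le> r\<close> j by simp
    qed
  next
    assume "f \<in> frac_ideal (- j)"
    then show "fls_abs f \<le> r"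
      using fls_abs_le_iff[of f "- j"] j by simp
  qed
  then have "{v. body_norm h v \<le> r} = body_ball h (- j)"
    by (auto simp: body_norm_def body_ball_def vecs_def)
  then show ?thesis using j by (intro that[of "- j"]) simp_all
qed

text \<open>Any admissible radius can be rounded down to a power of q with the same ball. So the
  \<open>LEAST\<close> over the reals is attained, at the smallest ball of sufficient
  dimension.\<close>

lemma succ_min_eq:
  fixes h :: "'a::{finite,field} fls ^ 'n ^ 'n::finite"
  assumes "\<And>k. i \<le> vec.dim (S \<inter> body_ball h k) \<longleftrightarrow> k \<le> a"
  shows "succ_min i h S = real CARD('a) powi (- a)"
  unfolding succ_min_def vec.dim_span
proof (rule Least_equality)
  have "{v. body_norm h v \<le> real CARD('a) powi (- a)} = body_ball h a"
    by (simp only: body_norm_le_iff Collect_mem_eq)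
  then show "0 < real CARD('a) powi (- a) \<and> i \<le> vec.dim (S \<inter> {v. body_norm h v \<le> real CARD('a) powi (- a)})"
    using assms[of a] by simp
next
  fix r :: real assume r: "0 < r \<and> i \<le> vec.dim (S \<inter> {v. body_norm h v \<le> r})"
  then obtain k where k: "{v. body_norm h v \<le> r} = body_ball h k" "real CARD('a) powi (- k) \<le> r"
    using body_norm_ball by metis
  then have "k \<le> a" using r assms by simp
  then have "real CARD('a) powi (- a) \<le> real CARD('a) powi (- k)"
    using card_field_gt_1[where 'a='a] by (intro power_int_increasing) auto
  then show "real CARD('a) powi (- a) \<le> r" using k by simp
qed

section \<open>Comparison of the point count with the volume\<close>

theorem theorem1p6:
  fixes g h :: "'a::{finite,field} fls ^ 'n ^ 'n::finite"
    and S :: "('a fls ^ 'n) set"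
    and m :: "('a fls ^ 'n) measure"
    and N :: nat
  assumes "CARD('n) \<ge> 2"
    and "normalized_haar m"
    and "invertible g"
    and "invertible h"
    and "periodic_lattice g N S"
  shows "succ_min 1 h S ^ CARD('n)
           \<le> lattice_det g / (real CARD('a) ^ N * measure m (convex_body h))
         \<and> (\<Prod>i = 1..CARD('n). succ_min i h S)
           \<le> lattice_det g / (real CARD('a) ^ N * measure m (convex_body h))"
proof -
  note m = assms(2) and g = assms(3) and h = assms(4) and S = assms(5)
  define q where "q = real CARD('a)"
  define d where "d = CARD('n)"
  define D where "D k = vec.dim (S \<inter> body_ball h k)" for k
  have q: "1 < q" unfolding q_def by (rule card_field_gt_1)
  have "antimono D"
    using body_ball_antimono[of _ _ h]
    unfolding D_def by (intro antimonoI vec.dim_subset) blast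
  \<comment> \<open>The ball of index \<open>K\<close> is the large ball in which points are
    counted, from above by dimensions and from below by volume.\<close>
  obtain K where K: "\<And>k. k \<le> K \<Longrightarrow> (*v) g ` vecs (frac_ideal 0) \<subseteq> body_ball h k"
    using image_frac_ideal_0_subset_body_ball by metis
  have full: "D k = d" if "k \<le> K" for k
    unfolding D_def d_def
    using K[OF that] by (intro dim_Int_body_ball_full[OF g] lattice_subset_periodic_lattice[OF S])
  have fund: "fund_domain g \<subseteq> body_ball h k" if "k \<le> K" for k
    using K[OF that] fund_domain_subset_image by blast
  \<comment> \<open>The exact count applies to balls containing the fundamental domain; any other
    ball lies in the one of index \<open>min k K\<close>.\<close>
  have fin: "finite (S \<inter> body_ball h k)" for k
    by (rule finite_subset[OF _ periodic_lattice_Int_body_ball(1)[OF S g h fund[of "min k K"]]])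
       (use body_ball_antimono[of "min k K" k h] in auto)
  obtain K' where K': "K \<le> K'" "\<And>k. K' \<le> k \<Longrightarrow> S \<inter> body_ball h k \<subseteq> {0}"
    using body_ball_eventually_trivial[OF h fin] by metis
  have zero: "D k = 0" if "K' \<le> k" for k
    using vec.dim_subset[OF K'(2)[OF that]] by (simp add: D_def)
  obtain a where a: "\<And>i k. i \<in> {1..d} \<Longrightarrow> i \<le> D k \<longleftrightarrow> k \<le> a i"
    and aK: "\<And>i. i \<in> {1..d} \<Longrightarrow> K \<le> a i"
    and sum_D: "int (\<Sum>j\<in>{K..<K'}. D j) = (\<Sum>i=1..d. a i - K + 1)"
    using antimono_jumps[OF \<open>antimono D\<close> full zero] by metis
  have min: "succ_min i h S = q powi (- a i)" if "i \<in> {1..d}" for i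
    unfolding q_def using a[OF that] by (intro succ_min_eq) (simp add: D_def)
  define c where "c = card (lattice g \<inter> body_ball h K)"
  define G where "G = fls_abs (det g)"
  define H where "H = fls_abs (det h)"
  have GH: "0 < G" "0 < H"
    using g h by (simp_all add: G_def H_def fls_abs_pos invertible_det_nz)
  have H: "measure m (convex_body h) = H"
    using haar_convex_body[OF m h] GH by (simp add: measure_def H_def)
  \<comment> \<open>Lower bound for the number \<open>c\<close> of lattice points. The exponent
    \<open>- 1 * int d\<close> arises because the fundamental domain is built from m rather than
    O.\<close>
  have "ennreal (H * q powi (- K * int d)) \<le> of_nat c * ennreal (G * q powi (- 1 * int d))"
    using emeasure_body_ball_le[OF m g h fund[OF order_refl]]
    unfolding body_ball_eq_image[OF h] fund_domain_eq emeasure_image_frac_ideal[OF m g]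
      emeasure_image_frac_ideal[OF m h]
    by (simp add: c_def G_def H_def q_def d_def body_ball_eq_image[OF h])
  also have "\<dots> = ennreal (real c * (G * q powi (- 1 * int d)))"
    using GH q by (simp add: ennreal_of_nat_eq_real_of_nat ennreal_mult)
  finally have vol: "H * q powi (- K * int d) \<le> real c * (G * q powi (- 1 * int d))"
    using GH q by (subst (asm) ennreal_le_iff) auto
  \<comment> \<open>Upper bound for the same ball: each of its \<open>c\<close> lattice points
    accounts for q^N points of \<open>S\<close>, and their total is bounded by the dimensions of the
    smaller balls.\<close>
  have "c * CARD('a) ^ N \<le> CARD('a) ^ (\<Sum>j\<in>{K..<K'}. D j)"
    using card_Int_body_ball_le_power[OF fin periodic_lattice_diff[OF S] K'(2)[OF order_refl] K'(1)]
    unfolding periodic_lattice_Int_body_ball(2)[OF S g h fund[OF order_refl]]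
    by (simp add: D_def c_def)
  then have "real (c * CARD('a) ^ N) \<le> real (CARD('a) ^ (\<Sum>j\<in>{K..<K'}. D j))"
    by (rule of_nat_mono)
  then have "real c * q ^ N \<le> q powi int (\<Sum>j\<in>{K..<K'}. D j)"
    unfolding power_int_of_nat by (simp add: q_def)
  also have "\<dots> = q powi ((\<Sum>i=1..d. a i) + (1 - K) * int d)"
    unfolding sum_D by (simp add: sum.distrib sum_subtractf algebra_simps)
  finally have cnt: "real c * q ^ N \<le> q powi (\<Sum>i=1..d. a i) * q powi ((1 - K) * int d)"
    using q by (simp add: power_int_add)
  have "H * q powi (- K * int d) * q ^ N \<le> G * q powi (- 1 * int d) * (real c * q ^ N)"
    using mult_right_mono[OF vol, of "q ^ N"] q by (simp add: mult_ac)
  also have "\<dots> \<le> G * q powi (- 1 * int d) * (q powi (\<Sum>i=1..d. a i) * q powi ((1 - K) * int d))"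
    using cnt GH q by (intro mult_left_mono) auto
  also have "\<dots> = G * q powi (\<Sum>i=1..d. a i) * (q powi (- 1 * int d) * q powi ((1 - K) * int d))"
    by (simp only: mult_ac)
  \<comment> \<open>The q^-d of the fundamental domain absorbs the + 1 in each of the
    \<open>d\<close> jumps. What remains is the volume factor of the ball, so \<open>K\<close>
    cancels.\<close>
  also have "q powi (- 1 * int d) * q powi ((1 - K) * int d) = q powi (- K * int d)"
    using q by (simp add: algebra_simps flip: power_int_add)
  finally have "H * q ^ N \<le> G * q powi (\<Sum>i=1..d. a i)"
    using q by (simp add: mult_ac)
  then have bound: "q powi (- (\<Sum>i=1..d. a i)) \<le> G / (q ^ N * H)"
    using GH q by (simp add: power_int_minus field_simps)
  have "(\<Prod>i=1..d. succ_min i h S) = (\<Prod>i=1..d. q powi (- a i))"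
    using min by (intro prod.cong) auto
  also have "\<dots> = q powi (- (\<Sum>i=1..d. a i))"
    using q power_int_sum[of q "\<lambda>i. - a i" "{1..d}"] by (simp add: sum_negf)
  finally have prod: "(\<Prod>i=1..d. succ_min i h S) \<le> G / (q ^ N * H)"
    using bound by simp
  have "1 \<in> {1..d}" using assms(1) by (simp add: d_def)
  \<comment> \<open>At index \<open>a i\<close> the dimension is at least \<open>i \<ge> 1\<close>,
    so \<open>a 1\<close> is the largest exponent and the first minimum the smallest. Thus (1)
    follows from (2).\<close>
  have "a i \<le> a 1" if "i \<in> {1..d}" for i
    using a[OF that, of "a i"] a[OF \<open>1 \<in> {1..d}\<close>, of "a i"] that by auto
  then have "succ_min 1 h S \<le> succ_min i h S" if "i \<in> {1..d}" for i
    using q that \<open>1 \<in> {1..d}\<close> by (simp add: min power_int_increasing del: atLeastAtMost_iff)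
  then have "(\<Prod>i=1..d. succ_min 1 h S) \<le> (\<Prod>i=1..d. succ_min i h S)"
    using q min[OF \<open>1 \<in> {1..d}\<close>] by (intro prod_mono) auto
  then have "succ_min 1 h S ^ d \<le> (\<Prod>i=1..d. succ_min i h S)"
    by simp
  then show ?thesis
    using prod by (simp add: H G_def lattice_det_def q_def d_def)
qed

end
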